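(* Let $\{x_n\}_{n\in\mathbb{N}}$ be a strong divisibility sequence with $x_1=1$ such that $x_n$ has a primitive prime divisor for all but finitely many $n$. Then there exists a strictly increasing continuous function $f:\mathbb{R}_{\geq 1}\to\mathbb{R}$ such that, for all $z\geq 1$ and all $n\in\mathbb{N}$, $n\leq f(z)$ implies $x_n\leq z$. Moreover, for any such function $f$ there is a constant $K>0$ (depending only on the sequence and on $f$) such that, for every positive integer $N$ and every $z\geq 1$ with $f(z)>1$, $$\#\left\{n\leq N : \text{every prime } p\mid x_n \text{ satisfies } p>z\right\}\leq K\left(\frac{N}{\log f(z)}+f(z)^2\right).$$
   Context: $\mathbb{N}$ denotes the positive integers. A strong divisibility sequence (SDS) is a sequence of positive integers $\{x_n\}_{n\in\mathbb{N}}$ such that $\gcd(x_n,x_m)=x_{\gcd(n,m)}$ for all $m,n\geq 1$. The term $x_n$ has a primitive prime divisor if there exists a prime $q$ such that $q\mid x_n$ but $q\nmid x_k$ for all $1\leq k<n$. *)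

theory Defs
  imports Complex_Main "HOL-Computational_Algebra.Primes"
begin

text \<open>
  Sequences are indexed by the positive integers. They are modelled as total functions on
  \<^typ>\<open>nat\<close>; the value at \<open>0\<close> is never constrained nor used.
\<close>

definition strong_divisibility_sequence :: "(nat \<Rightarrow> nat) \<Rightarrow> bool" where
  "strong_divisibility_sequence x \<longleftrightarrow>
     (\<forall>n\<ge>1. x n > 0) \<and> (\<forall>m\<ge>1. \<forall>n\<ge>1. gcd (x n) (x m) = x (gcd n m))"

definition has_primitive_prime_divisor :: "(nat \<Rightarrow> nat) \<Rightarrow> nat \<Rightarrow> bool" where
  "has_primitive_prime_divisor x n \<longleftrightarrow>
     (\<exists>q. prime q \<and> q dvd x n \<and> (\<forall>k. 1 \<le> k \<and> k < n \<longrightarrow> \<not> q dvd x k))"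

text \<open>
  A function on the reals \<open>\<ge> 1\<close> is modelled as a total function of which only the values on
  \<open>{1..}\<close> matter.
\<close>

definition admissible :: "(nat \<Rightarrow> nat) \<Rightarrow> (real \<Rightarrow> real) \<Rightarrow> bool" where
  "admissible x f \<longleftrightarrow>
     strict_mono_on {1..} f \<and> continuous_on {1..} f \<and>
     (\<forall>z\<ge>1. \<forall>n\<ge>1. real n \<le> f z \<longrightarrow> real (x n) \<le> z)"

end

theory Submission
  imports Defs "HOL-Number_Theory.Prime_Powers" "HOL-Analysis.Harmonic_Numbers"
begin

text \<open>
  Write \<open>y = f z\<close>. If \<open>r \<le> y\<close> is a prime for which \<open>x r\<close> has a primitive prime divisor \<open>q\<close>, then
  \<open>q \<le> x r \<le> z\<close>, and \<open>r dvd n\<close> forces \<open>q dvd x n\<close>. So the \<open>n\<close> to be counted avoid all primes up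
  to \<open>y\<close> outside a finite set \<open>E\<close>. If \<open>N < y\<close>, the term \<open>y\<^sup>2\<close> suffices. Otherwise no sieve
  machinery is needed: the set \<open>A\<close> of such \<open>n \<le> N\<close> is closed under divisors, so summing
  \<open>ln n = (\<Sum>d | d dvd n. mangoldt d)\<close> over \<open>A\<close> and using Chebyshev's bound gives
  \<open>card A * ln N \<le> 7 * N * L\<close> with \<open>L = (\<Sum>n\<in>A. 1 / n)\<close>. Multiplying \<open>L\<close> by the sum of \<open>1 / m\<close>
  over the \<open>m \<le> y\<close> free of primes from \<open>E\<close>, which is of order \<open>ln y\<close>, yields a part of
  \<open>\<Sum>k\<le>N*y. 1 / k\<close>, so that \<open>L\<close> is of order at most \<open>ln N / ln y\<close>.
\<close>

subsection \<open>Chebyshev's upper bound\<close>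

lemma card_multiples:
  fixes d n :: nat
  assumes "d > 0"
  shows "card {k \<in> {1..n}. d dvd k} = n div d"
proof -
  have "{k \<in> {1..n}. d dvd k} = (*) d ` {1..n div d}"
    using assms by (auto elim!: dvdE simp: less_eq_div_iff_mult_less_eq mult.commute)
  then show ?thesis
    using assms by (simp add: card_image inj_on_def)
qed

text \<open>Split each \<open>ln k\<close> by \<open>mangoldt_sum\<close> and swap the sums. The
  range may exceed n because \<open>n div d = 0\<close> for d > n; this lets n! and (2n)! be
  expanded over one range.\<close>

lemma ln_fact_eq_sum_mangoldt:
  assumes "n \<le> M"
  shows "ln (fact n :: real) = (\<Sum>d=1..M. mangoldt d * real (n div d))"
proof -
  have "ln (fact n :: real) = (\<Sum>k=1..n. ln (real k))"
    unfolding fact_prod of_nat_prod by (subst ln_prod) auto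
  also have "\<dots> = (\<Sum>k=1..n. \<Sum>d\<in>{d \<in> {1..M}. d dvd k}. mangoldt d)"
  proof (intro sum.cong refl)
    fix k assume k: "k \<in> {1..n}"
    then have "{d. d dvd k} = {d \<in> {1..M}. d dvd k}"
      using assms by (force intro: Nat.gr0I dest: dvd_imp_le)
    then show "ln (real k) = (\<Sum>d\<in>{d \<in> {1..M}. d dvd k}. mangoldt d)"
      using mangoldt_sum[of k, where ?'a = real] k by simp
  qed
  also have "\<dots> = (\<Sum>d=1..M. \<Sum>k\<in>{k \<in> {1..n}. d dvd k}. mangoldt d)"
    by (rule sum.swap_restrict) auto
  also have "\<dots> = (\<Sum>d=1..M. mangoldt d * real (n div d))"
    by (intro sum.cong refl) (simp only: sum_constant card_multiples, simp add: card_multiples[simplified])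
  finally show ?thesis .
qed

text \<open>In the logarithm of the central binomial coefficient, \<open>mangoldt d\<close> carries
  the weight \<open>2*n div d - 2 * (n div d)\<close>, which is never negative and is at least 1 for
  n < d \<le> 2n. The binomial itself is at most 4^n.\<close>

lemma sum_mangoldt_dyadic_le:
  "(\<Sum>d\<in>{n<..2*n}. mangoldt d) \<le> 2 * real n * ln 2"
proof -
  have "(\<Sum>d\<in>{n<..2*n}. mangoldt d)
      \<le> (\<Sum>d\<in>{1..2*n}. mangoldt d * (real (2*n div d) - 2 * real (n div d)))"
  proof (rule sum_le_included[where i = "\<lambda>d. d"])
    show "\<forall>d\<in>{1..2*n}. 0 \<le> mangoldt d * (real (2*n div d) - 2 * real (n div d))"
    proof
      fix d assume "d \<in> {1..2*n}"
      then have "2 * (n div d) \<le> 2 * n div d"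
        by (simp add: less_eq_div_iff_mult_less_eq)
      then have "2 * real (n div d) \<le> real (2 * n div d)"
        by linarith
      then show "0 \<le> mangoldt d * (real (2*n div d) - 2 * real (n div d))"
        by (simp add: mangoldt_nonneg)
    qed
    show "\<forall>d\<in>{n<..2*n}. \<exists>e\<in>{1..2*n}. e = d \<and>
        mangoldt d \<le> mangoldt e * (real (2*n div e) - 2 * real (n div e))"
    proof
      fix d assume d: "d \<in> {n<..2*n}"
      then have "1 \<le> 2 * n div d"
        by (simp add: less_eq_div_iff_mult_less_eq)
      then have "mangoldt d * 1 \<le> mangoldt d * (real (2*n div d) - 2 * real (n div d))"
        using d by (intro mult_left_mono mangoldt_nonneg) auto
      then show "\<exists>e\<in>{1..2*n}. e = d \<and>
          mangoldt d \<le> mangoldt e * (real (2*n div e) - 2 * real (n div e))"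
        using d by auto
    qed
  qed auto
  also have "\<dots> = ln (fact (2*n)) - 2 * ln (fact n)"
    unfolding ln_fact_eq_sum_mangoldt[OF order_refl, of "2*n"]
      ln_fact_eq_sum_mangoldt[of n "2*n", simplified]
    by (simp add: sum_subtractf sum_distrib_left right_diff_distrib mult_ac)
  also have "\<dots> \<le> 2 * real n * ln 2"
  proof -
    have "fact (2*n) = (fact n * fact n * of_nat (2*n choose n) :: real)"
    proof -
      have "fact n * fact (2*n - n) * (2*n choose n) = fact (2*n)"
        by (rule binomial_fact_lemma) simp
      then have "fact n * fact n * (2*n choose n) = fact (2*n)"
        by simp
      then show ?thesis
        by (metis of_nat_fact of_nat_mult)
    qed
    also have "\<dots> \<le> fact n * fact n * 2 ^ (2*n)"
      using of_nat_mono[OF binomial_le_pow2[of "2*n" n], where ?'a = real]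
      by (intro mult_left_mono) simp_all
    finally have "ln (fact (2*n)) \<le> ln (fact n * fact n * 2 ^ (2*n) :: real)"
      by (subst ln_le_cancel_iff) auto
    then show ?thesis
      by (simp add: ln_mult ln_realpow)
  qed
  finally show ?thesis .
qed

lemma sum_mangoldt_le: "(\<Sum>d=1..n. mangoldt d) \<le> 6 * real n"
proof (induction n rule: less_induct)
  case (less n)
  show ?case
  proof (cases "n \<le> 1")
    case True
    then show ?thesis
      by (cases n) auto
  next
    case False
    \<comment> \<open>Half of n rounded up, so that the dyadic block above m reaches n.\<close>
    define m where "m = (n + 1) div 2"
    have m: "m < n" "n \<le> 2 * m" "2 * m \<le> n + 1"
      using False by (auto simp: m_def)
    have "(\<Sum>d=1..n. mangoldt d) \<le> (\<Sum>d\<in>{1..m} \<union> {m<..2*m}. mangoldt d :: real)"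
      using m by (intro sum_mono2) (auto simp: mangoldt_nonneg)
    also have "\<dots> = (\<Sum>d=1..m. mangoldt d) + (\<Sum>d\<in>{m<..2*m}. mangoldt d)"
      by (rule sum.union_disjoint) auto
    also have "\<dots> \<le> 6 * real m + 2 * real m * 1"
    proof (intro add_mono less.IH m)
      have "2 * real m * ln 2 \<le> 2 * real m * 1"
        using ln_2_less_1 by (intro mult_left_mono) auto
      then show "(\<Sum>d\<in>{m<..2*m}. mangoldt d) \<le> 2 * real m * 1"
        using sum_mangoldt_dyadic_le[of m] by linarith
    qed
    \<comment> \<open>8m \<le> 4(n + 1) \<le> 6n, the last because n \<ge> 2; the constant 6 makes
      the induction close.\<close>
    also have "\<dots> \<le> 6 * real n"
      using m False by linarith
    finally show ?thesis .
  qed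
qed

subsection \<open>Divisor-closed sets\<close>

text \<open>Write ln N = ln n + ln (N/n). In a factorisation n = m * d closure puts m into A, so the
  first part is at most the sum over m in A of the Chebyshev sums up to N/m, giving the factor 6; ln
  t \<le> t - 1 bounds the second part and adds 1.\<close>

lemma card_divisor_closed_le:
  assumes A: "A \<subseteq> {1..N}" and closed: "\<And>n d. n \<in> A \<Longrightarrow> d dvd n \<Longrightarrow> d \<in> A"
  shows "real (card A) * ln (real N) \<le> 7 * real N * (\<Sum>n\<in>A. 1 / real n)"
proof -
  have fin: "finite A"
    using A finite_subset by blast
  have pos: "n > 0" "n \<le> N" if "n \<in> A" for n
    using A that by (auto simp: Suc_le_eq)
  have "(\<Sum>n\<in>A. ln (real n)) = (\<Sum>n\<in>A. \<Sum>d | d dvd n. mangoldt d)"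
    by (intro sum.cong refl) (use pos mangoldt_sum[where ?'a = real] in force)
  also have "\<dots> = (\<Sum>(n, d)\<in>(SIGMA n:A. {d. d dvd n}). mangoldt d)"
    by (rule sum.Sigma) (use fin pos in auto)
  also have "\<dots> \<le> (\<Sum>(m, d)\<in>(SIGMA m:A. {1..N div m}). mangoldt d)"
  proof (rule sum_le_included[where i = "\<lambda>(m, d). (m * d, d)"])
    show "\<forall>p\<in>(SIGMA n:A. {d. d dvd n}). \<exists>q\<in>(SIGMA m:A. {1..N div m}).
        (case q of (m, d) \<Rightarrow> (m * d, d)) = p \<and>
        (case p of (n, d) \<Rightarrow> mangoldt d) \<le> (case q of (m, d) \<Rightarrow> (mangoldt d :: real))"
    proof safe
      fix n d assume n: "n \<in> A" and "d dvd n"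
      then obtain m where m: "n = m * d"
        by (metis dvd_def mult.commute)
      have "m \<in> A"
        using closed[OF n, of m] m by simp
      moreover have "d \<in> {1..N div m}"
        using pos[OF n] m by (auto simp: less_eq_div_iff_mult_less_eq mult.commute Suc_le_eq)
      ultimately show "\<exists>q\<in>(SIGMA m:A. {1..N div m}). (case q of (m, d) \<Rightarrow> (m * d, d)) = (n, d) \<and>
          mangoldt d \<le> (case q of (m, d) \<Rightarrow> (mangoldt d :: real))"
        using m by (intro bexI[of _ "(m, d)"]) auto
    qed
  qed (use fin pos mangoldt_nonneg in auto)
  also have "\<dots> = (\<Sum>m\<in>A. \<Sum>d=1..N div m. mangoldt d)"
    by (rule sum.Sigma[symmetric]) (use fin in auto)
  also have "\<dots> \<le> (\<Sum>m\<in>A. 6 * real N * (1 / real m))"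
  proof (intro sum_mono)
    fix m
    have "6 * real (N div m) \<le> 6 * (real N / real m)"
      using of_nat_div_le_of_nat[of N m, where ?'a = real] by simp
    then show "(\<Sum>d=1..N div m. mangoldt d) \<le> 6 * real N * (1 / real m)"
      using sum_mangoldt_le[of "N div m"] by simp
  qed
  finally have 1: "(\<Sum>n\<in>A. ln (real n)) \<le> 6 * real N * (\<Sum>n\<in>A. 1 / real n)"
    by (simp add: sum_distrib_left)
  have "(\<Sum>n\<in>A. ln (real N) - ln (real n)) \<le> (\<Sum>n\<in>A. real N * (1 / real n))"
  proof (intro sum_mono)
    fix n assume "n \<in> A"
    then have "n > 0" "N > 0"
      using pos by fastforce+
    then show "ln (real N) - ln (real n) \<le> real N * (1 / real n)"
      using ln_le_minus_one[of "real N / real n"] by (simp add: ln_div)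
  qed
  then have "real (card A) * ln (real N) - (\<Sum>n\<in>A. ln (real n)) \<le> real N * (\<Sum>n\<in>A. 1 / real n)"
    by (simp add: sum_subtractf sum_distrib_left)
  with 1 show ?thesis
    by (simp add: algebra_simps)
qed

subsection \<open>Reciprocal sums\<close>

text \<open>\<open>harm n - ln n\<close> decreases from its value 1 at n = 1.\<close>

lemma sum_inverse_le:
  assumes "n > 0"
  shows "(\<Sum>k=1..n. 1 / real k) \<le> 1 + ln (real n)"
  using euler_mascheroni_sequence_decreasing[of 1 n] assms
  by (simp add: harm_def inverse_eq_divide)

text \<open>By coprimality a product a * b determines both factors, so expanding the left side gives
  reciprocals of distinct integers up to N * Y.\<close>

lemma sum_inverse_coprime_le:
  assumes A: "A \<subseteq> {1..N}" and B: "B \<subseteq> {1..Y}"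
    and cop: "\<And>a b. a \<in> A \<Longrightarrow> b \<in> B \<Longrightarrow> coprime a b"
  shows "(\<Sum>n\<in>A. 1 / real n) * (\<Sum>m\<in>B. 1 / real m) \<le> (\<Sum>k=1..N*Y. 1 / real k)"
proof -
  have inj: "inj_on (\<lambda>(a, b). a * b) (A \<times> B)"
  proof (rule inj_onI, clarify)
    fix a b a' b'
    assume H: "a \<in> A" "b \<in> B" "a' \<in> A" "b' \<in> B" "a * b = a' * b'"
    then have "a dvd a' * b'" "a' dvd a * b"
      by (metis dvd_triv_left)+
    moreover have "coprime a b'" "coprime a' b"
      using H by (blast intro: cop)+
    ultimately have "a = a'"
      by (intro dvd_antisym) (simp_all add: coprime_dvd_mult_left_iff)
    moreover have "a > 0"
      using A H by (auto simp: Suc_le_eq)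
    ultimately show "a = a' \<and> b = b'"
      using H by simp
  qed
  have "(\<Sum>n\<in>A. 1 / real n) * (\<Sum>m\<in>B. 1 / real m)
      = (\<Sum>p\<in>A \<times> B. 1 / real (case p of (a, b) \<Rightarrow> a * b))"
    by (simp add: sum_product sum.cartesian_product split_def)
  also have "\<dots> = (\<Sum>k\<in>(\<lambda>(a, b). a * b) ` (A \<times> B). 1 / real k)"
    using inj by (simp add: sum.reindex)
  also have "\<dots> \<le> (\<Sum>k=1..N*Y. 1 / real k)"
  proof (rule sum_mono2)
    show "(\<lambda>(a, b). a * b) ` (A \<times> B) \<subseteq> {1..N*Y}"
      using A B by (force simp: Suc_le_eq intro: mult_le_mono)
  qed auto
  finally show ?thesis .
qed

text \<open>Used with the exceptional primes as E: avoiding them costs a factor that depends on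
  their number alone, not on Y.\<close>

lemma sum_inverse_le_avoiding_divisors:
  assumes "finite E" and "\<And>p. p \<in> E \<Longrightarrow> p \<ge> 2"
  shows "(\<Sum>k=1..Y. 1 / real k)
    \<le> 2 ^ card E * (\<Sum>k | k \<in> {1..Y} \<and> (\<forall>p\<in>E. \<not> p dvd k). 1 / real k)"
  using assms
proof (induction E rule: finite_induct)
  case empty
  then show ?case
    by (auto intro!: sum_mono2)
next
  case (insert q E)
  let ?S = "{k. k \<in> {1..Y} \<and> (\<forall>p\<in>E. \<not> p dvd k)}"
  let ?S' = "{k. k \<in> {1..Y} \<and> (\<forall>p\<in>insert q E. \<not> p dvd k)}"
  let ?D = "{k \<in> ?S. q dvd k}"
  have q: "q \<ge> 2"
    using insert.prems by simp
  \<comment> \<open>Division by \<open>q \<ge> 2\<close> maps \<open>?D\<close> into \<open>?S\<close>, so \<open>?D\<close> carries at most half of the sum.\<close>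
  have "(\<Sum>k\<in>?D. 1 / real k) \<le> (\<Sum>k\<in>?S. 1 / 2 * (1 / real k))"
  proof (rule sum_le_included[where i = "(*) q"])
    show "\<forall>k\<in>?D. \<exists>j\<in>?S. q * j = k \<and> 1 / real k \<le> 1 / 2 * (1 / real j)"
    proof
      fix k assume k: "k \<in> ?D"
      then obtain j where j: "k = q * j"
        by auto
      have "j > 0"
        using k j by (auto intro: Nat.gr0I)
      moreover have "j \<le> Y"
        using k j q by (auto intro: order_trans[of j "q * j" Y])
      ultimately have "j \<in> ?S"
        using k j by auto
      moreover have "1 / real k \<le> 1 / 2 * (1 / real j)"
        using j q \<open>j > 0\<close> by (simp add: field_simps)
      ultimately show "\<exists>j\<in>?S. q * j = k \<and> 1 / real k \<le> 1 / 2 * (1 / real j)"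
        using j by auto
    qed
  qed auto
  moreover have "(\<Sum>k\<in>?S. 1 / real k) = (\<Sum>k\<in>?D. 1 / real k) + (\<Sum>k\<in>?S'. 1 / real k)"
    by (subst sum.union_disjoint[symmetric]) (auto intro!: sum.cong)
  ultimately have "(\<Sum>k\<in>?S. 1 / real k) \<le> 2 * (\<Sum>k\<in>?S'. 1 / real k)"
    unfolding sum_distrib_left[symmetric] by linarith
  then have "2 ^ card E * (\<Sum>k\<in>?S. 1 / real k) \<le> 2 ^ card E * (2 * (\<Sum>k\<in>?S'. 1 / real k))"
    by (intro mult_left_mono) auto
  also have "\<dots> = 2 ^ card (insert q E) * (\<Sum>k\<in>?S'. 1 / real k)"
    using insert.hyps by simp
  finally show ?case
    using insert.IH insert.prems by fastforce
qed

subsection \<open>The sieve bound\<close>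

text \<open>28 = 7 * 4, with 7 from \<open>card_divisor_closed_le\<close> and 4 from L * M \<le> 4
  ln N. The factor ln N then occurs on both sides and cancels.\<close>

lemma card_sieved_le:
  fixes y :: real
  assumes E: "finite E" and y: "y > 1" and N: "real N \<ge> y"
  shows "real (card {n \<in> {1..N}. \<forall>p. prime p \<and> p \<notin> E \<and> real p \<le> y \<longrightarrow> \<not> p dvd n})
    \<le> 28 * 2 ^ card E * real N / ln y"
proof -
  define A where "A = {n \<in> {1..N}. \<forall>p. prime p \<and> p \<notin> E \<and> real p \<le> y \<longrightarrow> \<not> p dvd n}"
  \<comment> \<open>E may contain 1, which divides everything and would empty B.\<close>
  define F where "F = {p \<in> E. prime p}"
  define Y where "Y = nat \<lfloor>y\<rfloor>"
  define B where "B = {k. k \<in> {1..Y} \<and> (\<forall>p\<in>F. \<not> p dvd k)}"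
  define L where "L = (\<Sum>n\<in>A. 1 / real n)"
  define M where "M = (\<Sum>m\<in>B. 1 / real m)"
  have Y: "Y \<ge> 1" "real Y \<le> y" "y < real Y + 1"
    using y by (auto simp: Y_def le_nat_iff)
  have N2: "N \<ge> 2" "Y \<le> N"
    using N y Y by linarith+
  have pos: "ln y > 0" "ln (real N) > 0" "L \<ge> 0"
    using y N2 by (auto simp: L_def sum_nonneg)
  have cardA: "real (card A) * ln (real N) \<le> 7 * real N * L"
    unfolding L_def
  proof (rule card_divisor_closed_le)
    fix n d assume "n \<in> A" "d dvd n"
    then show "d \<in> A"
      by (auto simp: A_def Suc_le_eq intro: Nat.gr0I dvd_trans dest: dvd_imp_le)
  qed (auto simp: A_def)
  have "L * M \<le> (\<Sum>k=1..N*Y. 1 / real k)"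
    unfolding L_def M_def
  proof (rule sum_inverse_coprime_le)
    fix a b assume a: "a \<in> A" and b: "b \<in> B"
    show "coprime a b"
    \<comment> \<open>A common prime p is at most Y as a divisor of b and lies outside E by the
      choice of B, so membership in A forbids it to divide a.\<close>
    proof (rule ccontr)
      assume "\<not> coprime a b"
      then obtain p where p: "prime p" "p dvd a" "p dvd b"
        by (metis coprime_iff_gcd_eq_1 gcd_greatest_iff prime_factor_nat dvd_refl)
      have "p \<le> Y"
        using p b by (auto simp: B_def dest!: dvd_imp_le)
      then have "real p \<le> y"
        using Y by linarith
      then show False
        using p a b by (auto simp: A_def B_def F_def)
    qed
  qed (auto simp: A_def B_def)
  also have "\<dots> \<le> 1 + ln (real (N * Y))"
    using N2 Y by (intro sum_inverse_le) auto
  also have "\<dots> \<le> 1 + (ln (real N) + ln (real N))"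
    using N2 Y by (simp add: ln_mult)
  also have "\<dots> \<le> 4 * ln (real N)"
  proof -
    \<comment> \<open>From ln (1 + t) \<le> t at t = -1/2; hence 1 \<le> 2 ln N.\<close>
    have "1 / 2 \<le> ln (2 :: real)"
      using ln_add_one_self_le_self2[of "-(1/2)"] by (simp add: ln_div)
    also have "\<dots> \<le> ln (real N)"
      using N2 by simp
    finally show ?thesis by simp
  qed
  finally have LM: "L * M \<le> 4 * ln (real N)" .
  \<comment> \<open>\<open>ln_le_harm\<close> bounds ln (Y + 1), which absorbs the rounding since y
    < Y + 1.\<close>
  have "ln y \<le> harm Y"
    using ln_le_harm[of Y] Y y by (smt (verit) ln_le_cancel_iff)
  also have "\<dots> \<le> 2 ^ card F * M"
    using sum_inverse_le_avoiding_divisors[of F Y] E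
    by (auto simp: F_def B_def M_def harm_def inverse_eq_divide prime_ge_2_nat)
  also have "\<dots> \<le> 2 ^ card E * M"
    using E by (intro mult_right_mono) (auto simp: F_def M_def intro!: card_mono sum_nonneg)
  finally have My: "ln y \<le> 2 ^ card E * M" .
  have "L * ln y \<le> L * (2 ^ card E * M)"
    using My pos by (intro mult_left_mono) auto
  also have "\<dots> = 2 ^ card E * (L * M)"
    by simp
  also have "\<dots> \<le> 2 ^ card E * (4 * ln (real N))"
    using LM by (intro mult_left_mono) auto
  finally have Ly: "L * ln y \<le> 2 ^ card E * (4 * ln (real N))" .
  have "(real (card A) * ln y) * ln (real N) = (real (card A) * ln (real N)) * ln y"
    by simp
  also have "\<dots> \<le> (7 * real N * L) * ln y"
    using cardA pos by (intro mult_right_mono) auto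
  also have "\<dots> = 7 * real N * (L * ln y)"
    by simp
  also have "\<dots> \<le> 7 * real N * (2 ^ card E * (4 * ln (real N)))"
    using Ly by (intro mult_left_mono) auto
  also have "\<dots> = (28 * 2 ^ card E * real N) * ln (real N)"
    by simp
  finally have "(real (card A) * ln y) * ln (real N) \<le> (28 * 2 ^ card E * real N) * ln (real N)" .
  then have "real (card A) * ln y \<le> 28 * 2 ^ card E * real N"
    using pos by simp
  then show ?thesis
    using pos by (simp add: A_def pos_le_divide_eq)
qed

section \<open>Application to strong divisibility sequences\<close>

lemma strong_divisibility_sequence_dvd:
  assumes "strong_divisibility_sequence x" "m \<ge> 1" "n \<ge> 1" "m dvd n"
  shows "x m dvd x n"
proof -
  have "gcd (x n) (x m) = x (gcd n m)"
    using assms by (simp add: strong_divisibility_sequence_def)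
  also have "gcd n m = m"
    using assms by (simp add: gcd_nat.absorb2)
  finally show ?thesis
    by (metis gcd_dvd1)
qed

theorem theorem1p4:
  fixes x :: "nat \<Rightarrow> nat"
  assumes "strong_divisibility_sequence x"
    and "x 1 = 1"
    and "finite {n. n \<ge> 1 \<and> \<not> has_primitive_prime_divisor x n}"
  shows "(\<exists>f. admissible x f) \<and>
    (\<forall>f. admissible x f \<longrightarrow>
      (\<exists>K::real. K > 0 \<and>
        (\<forall>N::nat. \<forall>z::real. N \<ge> 1 \<and> z \<ge> 1 \<and> f z > 1 \<longrightarrow>
          real (card {n. 1 \<le> n \<and> n \<le> N \<and> (\<forall>p. prime p \<and> p dvd x n \<longrightarrow> real p > z)})
            \<le> K * (real N / ln (f z) + (f z)\<^sup>2))))"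
proof (intro conjI allI impI)
  \<comment> \<open>A function with values below 1 is admissible, since \<open>n \<le> f z\<close> then never holds.\<close>
  have "admissible x (\<lambda>z. - 1 / z)"
    unfolding admissible_def
  proof (intro conjI allI impI)
    show "strict_mono_on {1..} (\<lambda>z::real. - 1 / z)"
      by (auto simp: strict_mono_on_def field_simps)
    show "continuous_on {1..} (\<lambda>z::real. - 1 / z)"
      by (auto intro!: continuous_intros)
    fix z :: real and n :: nat
    assume "z \<ge> 1" "n \<ge> 1" "real n \<le> - 1 / z"
    moreover from \<open>z \<ge> 1\<close> have "- 1 / z < 0"
      by simp
    ultimately show "real (x n) \<le> z"
      by linarith
  qed
  then show "\<exists>f. admissible x f"
    by blast
next
  fix f assume f: "admissible x f"
  define E where "E = {n. n \<ge> 1 \<and> \<not> has_primitive_prime_divisor x n}"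
  \<comment> \<open>The sieve constant; it depends only on the number of exceptional indices. K
    \<ge> 1 serves the case N < f z.\<close>
  define K :: real where "K = 28 * 2 ^ card E"
  have K: "K \<ge> 1"
    using one_le_power[of "2::real" "card E"] unfolding K_def by linarith
  have "real (card {n. 1 \<le> n \<and> n \<le> N \<and> (\<forall>p. prime p \<and> p dvd x n \<longrightarrow> real p > z)})
      \<le> K * (real N / ln (f z) + (f z)\<^sup>2)" (is "real (card ?S) \<le> _")
    if N: "N \<ge> 1" and z: "z \<ge> 1" and fz: "f z > 1" for N z
  proof (cases "real N \<ge> f z")
    case True
    let ?T = "{n \<in> {1..N}. \<forall>p. prime p \<and> p \<notin> E \<and> real p \<le> f z \<longrightarrow> \<not> p dvd n}"
    have "?S \<subseteq> ?T"
    proof (clarify, intro conjI allI impI)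
      fix n r
      assume n: "1 \<le> n" "n \<le> N" "\<forall>p. prime p \<and> p dvd x n \<longrightarrow> real p > z"
      show "n \<in> {1..N}"
        using n by simp
      assume r: "prime r \<and> r \<notin> E \<and> real r \<le> f z"
      then have r1: "r \<ge> 1"
        using prime_ge_1_nat by blast
      with r obtain q where q: "prime q" "q dvd x r"
        by (auto simp: E_def has_primitive_prime_divisor_def)
      have "x r > 0"
        using assms(1) r1 by (simp add: strong_divisibility_sequence_def)
      with q have "q \<le> x r"
        by (intro dvd_imp_le)
      moreover have "real (x r) \<le> z"
        using f z r r1 by (simp add: admissible_def)
      ultimately have "real q \<le> z"
        by linarith
      \<comment> \<open>If r divided n, then q would divide x n, whose prime factors all exceed
        z.\<close>
      then show "\<not> r dvd n"
        using strong_divisibility_sequence_dvd[OF assms(1) r1 n(1)] n(3) q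
        by (meson dvd_trans not_less)
    qed
    then have "real (card ?S) \<le> real (card ?T)"
      by (intro of_nat_mono card_mono) auto
    also have "\<dots> \<le> K * (real N / ln (f z))"
      using card_sieved_le[of E "f z" N] assms(3) fz True by (simp add: E_def K_def)
    also have "\<dots> \<le> K * (real N / ln (f z) + (f z)\<^sup>2)"
      using K by (intro mult_left_mono) auto
    finally show ?thesis .
  next
    case False
    have "card ?S \<le> card {1..N}"
      by (intro card_mono) auto
    then have "real (card ?S) \<le> f z"
      using False by simp
    also have "\<dots> \<le> (f z)\<^sup>2"
      using fz by (simp add: power2_eq_square)
    also have "\<dots> \<le> real N / ln (f z) + (f z)\<^sup>2"
      using fz by simp
    also have "\<dots> \<le> K * (real N / ln (f z) + (f z)\<^sup>2)"
      using K fz by (intro mult_right_mono[of 1 K, simplified]) auto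
    finally show ?thesis .
  qed
  then show "\<exists>K::real. K > 0 \<and>
      (\<forall>N::nat. \<forall>z::real. N \<ge> 1 \<and> z \<ge> 1 \<and> f z > 1 \<longrightarrow>
        real (card {n. 1 \<le> n \<and> n \<le> N \<and> (\<forall>p. prime p \<and> p dvd x n \<longrightarrow> real p > z)})
          \<le> K * (real N / ln (f z) + (f z)\<^sup>2))"
    using K by (intro exI[of _ K]) auto
qed

end
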